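(* Let $\Sigma$ be a finite alphabet and let $\langle \mathcal{A}(\Sigma),\star,\mathbf{0}\rangle$ be either the algebra of words over $\Sigma$, in which case assume $|\Sigma|\ge 2$, or the algebra of binary trees over $\Sigma$, in which case assume $|\Sigma|\ge 1$. If $f\colon \mathcal{A}(\Sigma)^n\to\mathcal{A}(\Sigma)$ is congruence preserving, then there exists a polynomial $P_f\in\mathcal{A}(\Sigma\cup\{x_1,\dots,x_n\})$ such that $f=\widetilde{P_f}$, i.e. $f(u_1,\dots,u_n)=\widetilde{P_f}(u_1,\dots,u_n)$ for all $u_1,\dots,u_n\in\mathcal{A}(\Sigma)$.
   Context: Algebra of words: $\mathcal{A}(\Sigma)=\Sigma^*$, $\star$ is concatenation and $\mathbf{0}$ is the empty word. Algebra of binary trees: $\mathcal{A}(\Sigma)$ is the set of (possibly empty) binary trees whose leaves are labelled by letters of $\Sigma$; $\mathbf{0}\notin\Sigma$ is the empty tree, each letter is a one-leaf tree, and $t\star t'$ is the tree with a root whose left subtree is $t$ and right subtree is $t'$. One has $\mathbf{0}\star\mathbf{0}=\mathbf{0}$, and every tree $t\notin\{\mathbf{0}\}\cup\Sigma$ is $t_1\star t_2$ for a unique pair $(t_1,t_2)\ne(\mathbf{0},\mathbf{0})$ (so $t\star\mathbf{0}$, $\mathbf{0}\star t$ and $t$ are distinct for $t\ne\mathbf{0}$); there are no other identifications, i.e. the elements $t\star t'$ with $(t,t')\neq(\mathbf 0,\mathbf 0)$ are not in $\{\mathbf{0}\}\cup\Sigma$, and all trees are generated by $\Sigma\cup\{\mathbf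 0\}$ under $\star$. A congruence on $\langle\mathcal{A},\star,\mathbf{0}\rangle$ is an equivalence relation $\sim$ such that $s_1\sim s_1'$ and $s_2\sim s_2'$ imply $s_1\star s_2\sim s_1'\star s_2'$. A function $f\colon\mathcal{A}^n\to\mathcal{A}$ is congruence preserving if for every congruence $\sim$ and all $t_i,t_i'\in\mathcal{A}$, $t_i\sim t_i'$ for $i=1,\dots,n$ implies $f(t_1,\dots,t_n)\sim f(t_1',\dots,t_n')$. An $n$-ary polynomial is an element $P$ of $\mathcal{A}(\Sigma\cup\{x_1,\dots,x_n\})$ (the same kind of algebra, over the alphabet enlarged by variables $x_i\notin\Sigma$). Its polynomial function $\widetilde P\colon\mathcal{A}(\Sigma)^n\to\mathcal{A}(\Sigma)$ is given by substitution: $\widetilde P(\vec u)=P$ if $P=\mathbf{0}$ or $P\in\Sigma$, $\widetilde{x_i}(\vec u)=u_i$, and $\widetilde{P_1\star P_2}(\vec u)=\widetilde{P_1}(\vec u)\star\widetilde{P_2}(\vec u)$. *)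

theory Defs
  imports Main
begin

section \<open>Congruences and congruence preserving functions\<close>

text \<open>An algebra is given by a type together with its binary operation. The constant
  \<open>0\<close> imposes no condition on congruences, so it is not a parameter here.\<close>

definition congruence :: "('t \<Rightarrow> 't \<Rightarrow> 't) \<Rightarrow> ('t \<times> 't) set \<Rightarrow> bool" where
  "congruence star r \<longleftrightarrow> equiv UNIV r \<and>
     (\<forall>s1 s1' s2 s2'. (s1, s1') \<in> r \<longrightarrow> (s2, s2') \<in> r \<longrightarrow> (star s1 s2, star s1' s2') \<in> r)"

text \<open>An \<open>n\<close>-ary function takes the list of its \<open>n\<close> arguments; its values on lists of any
  other length are irrelevant.\<close>

definition congruence_preserving :: "('t \<Rightarrow> 't \<Rightarrow> 't) \<Rightarrow> nat \<Rightarrow> ('t list \<Rightarrow> 't) \<Rightarrow> bool" where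
  "congruence_preserving star n f \<longleftrightarrow>
     (\<forall>r. congruence star r \<longrightarrow>
       (\<forall>ts ts'. length ts = n \<longrightarrow> length ts' = n \<longrightarrow>
          (\<forall>i<n. (ts ! i, ts' ! i) \<in> r) \<longrightarrow> (f ts, f ts') \<in> r))"

section \<open>Binary trees\<close>

text \<open>Because \<open>0 \<star> 0 = 0\<close>, no tree has an inner node with two empty subtrees. A nonempty
  tree is thus a leaf or a node whose left subtree, right subtree or both are nonempty; these
  cases are separate constructors, so that equality of trees is the datatype equality.\<close>

datatype (labels_ne: 'a) ne_tree =
    Leaf 'a
  | Left_Only "'a ne_tree"
  | Right_Only "'a ne_tree"
  | Both "'a ne_tree" "'a ne_tree"

datatype (labels: 'a) btree = Empty | Nonempty "'a ne_tree"

abbreviation leaf :: "'a \<Rightarrow> 'a btree" where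
  "leaf a \<equiv> Nonempty (Leaf a)"

fun tree_star :: "'a btree \<Rightarrow> 'a btree \<Rightarrow> 'a btree"  (infixr \<open>\<star>\<close> 65) where
  "Empty \<star> Empty = Empty"
| "Nonempty s \<star> Empty = Nonempty (Left_Only s)"
| "Empty \<star> Nonempty t = Nonempty (Right_Only t)"
| "Nonempty s \<star> Nonempty t = Nonempty (Both s t)"

lemma tree_star_eq_Empty_iff: "s \<star> t = Empty \<longleftrightarrow> s = Empty \<and> t = Empty"
  by (cases s; cases t) auto

lemma tree_star_neq_leaf: "s \<star> t \<noteq> leaf a"
  by (cases s; cases t) auto

lemma tree_star_inject:
  assumes "(s, t) \<noteq> (Empty, Empty)"
  shows "s \<star> t = s' \<star> t' \<longleftrightarrow> s = s' \<and> t = t'"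
  using assms by (cases s; cases t; cases s'; cases t') auto

lemma btree_induct_star:
  assumes empty: "Q Empty" and leaf: "\<And>a. Q (leaf a)"
    and star: "\<And>s t. Q s \<Longrightarrow> Q t \<Longrightarrow> Q (s \<star> t)"
  shows "Q t"
proof -
  have "Q (Nonempty u)" for u
  proof (induction u)
    case (Leaf a) show ?case by (rule leaf)
  next
    case (Left_Only u) show ?case using star[OF Left_Only empty] by simp
  next
    case (Right_Only u) show ?case using star[OF empty Right_Only] by simp
  next
    case (Both u v) show ?case using star[OF Both] by simp
  qed
  then show ?thesis using empty by (cases t) auto
qed

section \<open>Polynomials and polynomial functions\<close>

text \<open>\<open>Var i\<close> is the variable \<open>x\<^bsub>i+1\<^esub>\<close>: indices start at \<open>0\<close>, as for list positions.\<close>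

datatype 'a psym = Letter 'a | Var nat

definition poly_alphabet :: "nat \<Rightarrow> 'a psym set" where
  "poly_alphabet n = range Letter \<union> Var ` {..<n}"

definition word_polynomials :: "nat \<Rightarrow> 'a psym list set" where
  "word_polynomials n = lists (poly_alphabet n)"

definition tree_polynomials :: "nat \<Rightarrow> 'a psym btree set" where
  "tree_polynomials n = {P. labels P \<subseteq> poly_alphabet n}"

definition word_polyfun :: "'a psym list \<Rightarrow> 'a list list \<Rightarrow> 'a list" where
  "word_polyfun P us = concat (map (\<lambda>s. case s of Letter a \<Rightarrow> [a] | Var i \<Rightarrow> us ! i) P)"

primrec ne_tree_polyfun :: "'a psym ne_tree \<Rightarrow> 'a btree list \<Rightarrow> 'a btree" where
  "ne_tree_polyfun (Leaf s) us = (case s of Letter a \<Rightarrow> leaf a | Var i \<Rightarrow> us ! i)"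
| "ne_tree_polyfun (Left_Only P) us = ne_tree_polyfun P us \<star> Empty"
| "ne_tree_polyfun (Right_Only P) us = Empty \<star> ne_tree_polyfun P us"
| "ne_tree_polyfun (Both P Q) us = ne_tree_polyfun P us \<star> ne_tree_polyfun Q us"

primrec tree_polyfun :: "'a psym btree \<Rightarrow> 'a btree list \<Rightarrow> 'a btree" where
  "tree_polyfun Empty us = Empty"
| "tree_polyfun (Nonempty P) us = ne_tree_polyfun P us"

lemma word_polyfun_simps:
  "word_polyfun [] us = []"
  "word_polyfun [Letter a] us = [a]"
  "word_polyfun [Var i] us = us ! i"
  "word_polyfun (P @ Q) us = word_polyfun P us @ word_polyfun Q us"
  by (simp_all add: word_polyfun_def)

lemma tree_polyfun_simps:
  "tree_polyfun Empty us = Empty"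
  "tree_polyfun (leaf (Letter a)) us = leaf a"
  "tree_polyfun (leaf (Var i)) us = us ! i"
  "tree_polyfun (P \<star> Q) us = tree_polyfun P us \<star> tree_polyfun Q us"
  by simp_all (cases P; cases Q; simp)

end

theory Submission
  imports Defs
begin

text \<open>Let \<open>s = (s\<^sub>1, \<dots>, s\<^sub>n)\<close> be large elements without overlaps. Rewriting every \<open>s\<^sub>i\<close> into a
  smaller \<open>t\<^sub>i\<close> is then confluent and terminating, and equality of normal forms is a congruence
  that moves no small element. Hence \<open>f(t)\<close> is the normal form of \<open>f(s)\<close>. Replacing the
  occurrences of \<open>s\<^sub>i\<close> in \<open>f(s)\<close> by \<open>x\<^sub>i\<close> gives a polynomial \<open>P\<^sub>s\<close> with \<open>P\<^sub>s(s) = f(s)\<close>. If the \<open>t\<^sub>j\<close>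
  cannot overlap the \<open>s\<^sub>i\<close>, then \<open>P\<^sub>s(t)\<close> is already normal, so \<open>f(t) = P\<^sub>s(t)\<close>. Take two infinite
  families \<open>S\<close> and \<open>T\<close> of tuples that do not overlap each other: for \<open>s\<close> in \<open>S\<close>, the equation
  \<open>P\<^sub>s(T\<^sub>0) = f(T\<^sub>0)\<close> leaves finitely many candidates for \<open>P\<^sub>s\<close>, so one \<open>P\<close> serves infinitely many
  \<open>s\<close> and agrees with \<open>f\<close> on all of \<open>T\<close>. Rewriting a large member of \<open>T\<close> into an
  arbitrary tuple \<open>t\<close> then transfers \<open>f = P\<close> to \<open>t\<close>.\<close>

section \<open>Collapsing one tuple onto another\<close>

text \<open>The congruence is carried by a map \<open>N\<close> having it as kernel. As
  \<open>N\<close> fixes everything of length at most \<open>m\<close>, two such elements are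
  congruent only if they are equal, which turns congruences back into equations.\<close>

definition collapse ::
    "('t \<Rightarrow> 't \<Rightarrow> 't) \<Rightarrow> ('t \<Rightarrow> nat) \<Rightarrow> nat \<Rightarrow> 't list \<Rightarrow> 't list \<Rightarrow> ('t \<Rightarrow> 't) \<Rightarrow> bool" where
  "collapse star len m s t N \<longleftrightarrow>
     congruence star {(x, y). N x = N y} \<and>
     length s = length t \<and> (\<forall>i<length t. N (s ! i) = N (t ! i)) \<and>
     (\<forall>z. len z \<le> m \<longrightarrow> N z = z)"

lemma collapse_congruence_preserving:
  assumes "collapse star len m s t N" "congruence_preserving star (length t) f"
  shows "N (f s) = N (f t)"
  using assms unfolding collapse_def congruence_preserving_def by blast

text \<open>\<open>F\<close> is left free because the product of two normal forms may itself have to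
  be reduced.\<close>

lemma congruence_kernelI:
  assumes "\<And>x y. N (star x y) = F (N x) (N y)"
  shows "congruence star {(x, y). N x = N y}"
  using assms by (auto simp: congruence_def equiv_def refl_on_def sym_def trans_def)

text \<open>The argument shared by words and trees. The index \<open>m\<close> of a tuple is also
  the bound below which collapsing it moves nothing; \<open>interp\<close> is applied with
  \<open>z\<close> the value of \<open>f\<close> at \<open>S m\<close>.\<close>

lemma polynomial_interpolation:
  fixes S T :: "nat \<Rightarrow> 't list" and ev :: "'p \<Rightarrow> 't list \<Rightarrow> 't" and len :: "'t \<Rightarrow> nat"
  assumes cp: "congruence_preserving star n f"
    and ev_cp: "\<And>P. P \<in> polys \<Longrightarrow> congruence_preserving star n (ev P)"
    and lenT: "\<And>m. length (T m) = n"
    and colS: "\<And>m t. length t = n \<Longrightarrow> \<forall>u\<in>set t. len u \<le> m \<Longrightarrow> collapse star len m (S m) t (N (S m) t)"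
    and colT: "\<And>m t. length t = n \<Longrightarrow> \<forall>u\<in>set t. len u \<le> m \<Longrightarrow> collapse star len m (T m) t (N (T m) t)"
    and interp: "\<And>m z. \<exists>P\<in>polys. ev P (S m) = z \<and>
        (\<forall>k. (\<forall>u\<in>set (T k). len u \<le> m) \<longrightarrow> ev P (T k) = N (S m) (T k) z)"
    and fin: "\<And>w. finite {P\<in>polys. ev P (T 0) = w}"
  shows "\<exists>P\<in>polys. \<forall>us. length us = n \<longrightarrow> f us = ev P us"
proof -
  have bound: "\<exists>M. \<forall>u\<in>set us. len u \<le> M" for us
    by (metis List.finite_set finite_nat_set_iff_bounded_le finite_imageI imageI)
  have "\<forall>m. \<exists>P. P \<in> polys \<and>
      (\<forall>k. (\<forall>u\<in>set (T k). len u \<le> m) \<longrightarrow> ev P (T k) = N (S m) (T k) (f (S m)))"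
    using interp by blast
  then obtain p where p: "\<And>m. p m \<in> polys"
    "\<And>m k. \<forall>u\<in>set (T k). len u \<le> m \<Longrightarrow> ev (p m) (T k) = N (S m) (T k) (f (S m))"
    by metis
  have large: "\<exists>M. \<forall>m\<ge>M. f (T k) = ev (p m) (T k)" for k
  proof -
    \<comment> \<open>The bound also covers \<open>f (T k)\<close>, so that this value is its own
      normal form.\<close>
    obtain M where M: "\<forall>u\<in>set (f (T k) # T k). len u \<le> M" using bound by blast
    have "f (T k) = ev (p m) (T k)" if "m \<ge> M" for m
    proof -
      have le: "\<forall>u\<in>set (T k). len u \<le> m" and lef: "len (f (T k)) \<le> m"
        using M that by force+
      have c: "collapse star len m (S m) (T k) (N (S m) (T k))" using colS le lenT by blast
      have "N (S m) (T k) (f (S m)) = N (S m) (T k) (f (T k))"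
        using collapse_congruence_preserving[OF c] cp lenT by simp
      also have "\<dots> = f (T k)" using c lef by (simp add: collapse_def)
      finally show ?thesis using p(2)[OF le] by simp
    qed
    then show ?thesis by blast
  qed
  obtain M0 where M0: "\<And>m. m \<ge> M0 \<Longrightarrow> f (T 0) = ev (p m) (T 0)" using large by metis
  \<comment> \<open>From \<open>M0\<close> on, all chosen polynomials lie in one fibre of evaluation
    at \<open>T 0\<close>, so one of them recurs infinitely often.\<close>
  have "p ` {M0..} \<subseteq> {P\<in>polys. ev P (T 0) = f (T 0)}" using M0 p(1) by auto
  then have "finite (p ` {M0..})" using fin finite_subset by blast
  then obtain m0 where inf: "infinite {m \<in> {M0..}. p m = p m0}"
    using pigeonhole_infinite[of "{M0..}" p] infinite_Ici by blast
  have onT: "f (T k) = ev (p m0) (T k)" for k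
  proof -
    obtain M where M: "\<forall>m\<ge>M. f (T k) = ev (p m) (T k)" using large by blast
    \<comment> \<open>The threshold \<open>M\<close> depends on \<open>k\<close>, but infinitely
      many indices share the polynomial \<open>p m0\<close>, so some index lies above it.\<close>
    have "\<not> {m \<in> {M0..}. p m = p m0} \<subseteq> {..<M}"
      using inf finite_subset finite_lessThan by blast
    then obtain m where "m \<ge> M" "p m = p m0"
      by (metis (mono_tags, lifting) lessThan_iff mem_Collect_eq not_le subsetI)
    then show ?thesis using M by metis
  qed
  have "f us = ev (p m0) us" if us: "length us = n" for us
  proof -
    \<comment> \<open>Both values to be compared are bounded as well, so equality of their normal
      forms is equality.\<close>
    obtain m where m: "\<forall>u\<in>set (f us # ev (p m0) us # us). len u \<le> m" using bound by blast
    have c: "collapse star len m (T m) us (N (T m) us)" using colT us m by simp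
    have "N (T m) us (f us) = N (T m) us (ev (p m0) us)"
      using collapse_congruence_preserving[OF c, of f] cp us onT
        collapse_congruence_preserving[OF c, of "ev (p m0)"] ev_cp[OF p(1)] by simp
    then show ?thesis using c m by (simp add: collapse_def)
  qed
  then show ?thesis using p(1) by blast
qed

section \<open>Words\<close>

text \<open>The length condition is part of the step, so that rewriting terminates for every
  \<open>R\<close>.\<close>

definition rewrite_step :: "('a list \<times> 'a list) set \<Rightarrow> 'a list \<Rightarrow> 'a list \<Rightarrow> bool" where
  "rewrite_step R z z' \<longleftrightarrow>
     (\<exists>x s t y. (s, t) \<in> R \<and> length t < length s \<and> z = x @ s @ y \<and> z' = x @ t @ y)"

lemma rewrite_step_length: "rewrite_step R z z' \<Longrightarrow> length z' < length z"
  by (auto simp: rewrite_step_def)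

lemma rewrite_step_context: "rewrite_step R z z' \<Longrightarrow> rewrite_step R (u @ z @ v) (u @ z' @ v)"
  unfolding rewrite_step_def by (metis append.assoc)

text \<open>The step is chosen arbitrarily; \<open>word_nf_step\<close> shows that the choice is
  immaterial once \<open>R\<close> is \<open>nonoverlapping\<close>.\<close>

function word_nf :: "('a list \<times> 'a list) set \<Rightarrow> 'a list \<Rightarrow> 'a list" where
  "word_nf R z = (if \<exists>z'. rewrite_step R z z' then word_nf R (SOME z'. rewrite_step R z z') else z)"
  by auto
termination
  by (relation "measure (\<lambda>(R, z). length z)") (auto intro: rewrite_step_length someI)

declare word_nf.simps [simp del]

lemma word_nf_irreducible: "\<nexists>z'. rewrite_step R z z' \<Longrightarrow> word_nf R z = z"
  by (subst word_nf.simps) (simp only: if_False)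

lemma rewrite_step_word_nf: "\<not> rewrite_step R (word_nf R z) z'"
proof (induction R z rule: word_nf.induct)
  case (1 R z)
  show ?case
  proof (cases "\<exists>z'. rewrite_step R z z'")
    case True
    then show ?thesis using 1[OF True] by (subst word_nf.simps) simp
  next
    case False
    then show ?thesis by (simp add: word_nf_irreducible)
  qed
qed

lemma append_factors_disjoint:
  assumes "x @ u @ y = x' @ u' @ y'" "length x + length u \<le> length x'"
  obtains w where "x' = x @ u @ w" "y = w @ u' @ y'"
proof -
  have "(x @ u) @ y = x' @ (u' @ y')" using assms(1) by simp
  then show ?thesis using assms(2) that unfolding append_eq_append_conv2 by auto
qed

text \<open>This excludes critical pairs; the clause \<open>t = t'\<close> also makes the right-hand
  side of a matching rule unique.\<close>

definition nonoverlapping :: "('a list \<times> 'a list) set \<Rightarrow> bool" where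
  "nonoverlapping R \<longleftrightarrow> (\<forall>(s, t) \<in> R. \<forall>(s', t') \<in> R. \<forall>x y x' y'. x @ s @ y = x' @ s' @ y' \<longrightarrow>
     length x + length s \<le> length x' \<or> length x' + length s' \<le> length x \<or>
     x = x' \<and> s = s' \<and> t = t' \<and> y = y')"

text \<open>Disjoint occurrences can be rewritten in either order, and coinciding ones give the same
  result. The fact \<open>*\<close> treats the case where the first occurrence lies to the left; the
  other case is symmetric.\<close>

lemma rewrite_step_diamond:
  assumes "nonoverlapping R" "rewrite_step R z z1" "rewrite_step R z z2" "z1 \<noteq> z2"
  shows "\<exists>z'. rewrite_step R z1 z' \<and> rewrite_step R z2 z'"
proof -
  have *: "\<exists>z'. rewrite_step R (x @ t @ y) z' \<and> rewrite_step R (x' @ t' @ y') z'"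
    if d: "(s, t) \<in> R" "length t < length s" "(s', t') \<in> R" "length t' < length s'"
      "x @ s @ y = x' @ s' @ y'" "length x + length s \<le> length x'" for x s t y x' s' t' y'
  proof -
    obtain w where w: "x' = x @ s @ w" "y = w @ s' @ y'"
      using append_factors_disjoint[OF d(5,6)] .
    have st: "rewrite_step R s t" "rewrite_step R s' t'"
      unfolding rewrite_step_def using d(1-4) by (metis append_Nil append_Nil2)+
    have "rewrite_step R (x @ t @ y) (x @ t @ w @ t' @ y')"
      using rewrite_step_context[OF st(2), of "x @ t @ w" y'] w by simp
    moreover have "rewrite_step R (x' @ t' @ y') (x @ t @ w @ t' @ y')"
      using rewrite_step_context[OF st(1), of x "w @ t' @ y'"] w by simp
    ultimately show ?thesis by blast
  qed
  obtain x s t y where 1: "(s, t) \<in> R" "length t < length s" "z = x @ s @ y" "z1 = x @ t @ y"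
    using assms(2) unfolding rewrite_step_def by blast
  obtain x' s' t' y' where 2: "(s', t') \<in> R" "length t' < length s'" "z = x' @ s' @ y'" "z2 = x' @ t' @ y'"
    using assms(3) unfolding rewrite_step_def by blast
  have eq: "x @ s @ y = x' @ s' @ y'" using 1 2 by simp
  have "length x + length s \<le> length x' \<or> length x' + length s' \<le> length x \<or>
     x = x' \<and> s = s' \<and> t = t' \<and> y = y'"
    using assms(1) 1(1) 2(1) eq unfolding nonoverlapping_def by blast
  then show ?thesis
    using *[OF 1(1,2) 2(1,2) eq] *[OF 2(1,2) 1(1,2) eq[symmetric]] 1(4) 2(4) assms(4) by blast
qed

text \<open>As in Newman's lemma: the chosen successor of \<open>z\<close> and the given one have a
  common reduct, and both are shorter than \<open>z\<close>, so the induction hypothesis applies to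
  each.\<close>

lemma word_nf_step:
  assumes "nonoverlapping R"
  shows "rewrite_step R z z' \<Longrightarrow> word_nf R z = word_nf R z'"
proof (induction "length z" arbitrary: z z' rule: less_induct)
  case less
  define z1 where "z1 = (SOME z'. rewrite_step R z z')"
  have z1: "rewrite_step R z z1" unfolding z1_def using less.prems by (rule someI)
  have nf: "word_nf R z = word_nf R z1"
    unfolding z1_def using less.prems by (subst word_nf.simps) auto
  show ?case
  proof (cases "z1 = z'")
    case False
    then obtain w where "rewrite_step R z1 w" "rewrite_step R z' w"
      using rewrite_step_diamond[OF assms z1 less.prems] by blast
    then show ?thesis
      using less.hyps z1 less.prems rewrite_step_length nf by metis
  qed (use nf in simp)
qed

lemma word_nf_context:
  assumes "nonoverlapping R"
  shows "word_nf R (u @ word_nf R z @ v) = word_nf R (u @ z @ v)"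
proof (induction "length z" arbitrary: z rule: less_induct)
  case less
  show ?case
  proof (cases "\<exists>z'. rewrite_step R z z'")
    case True
    then obtain z' where "rewrite_step R z z'" by blast
    then show ?thesis
      using less[OF rewrite_step_length[of R z z']] word_nf_step[OF assms, of z z']
        word_nf_step[OF assms rewrite_step_context[of R z z' u v]] by simp
  qed (simp add: word_nf_irreducible)
qed

lemma word_nf_append:
  assumes "nonoverlapping R"
  shows "word_nf R (x @ y) = word_nf R (word_nf R x @ word_nf R y)"
  using word_nf_context[OF assms, of "[]" x y] word_nf_context[OF assms, of "word_nf R x" y "[]"]
  by simp

section \<open>Marker words and their occurrences\<close>

text \<open>\<open>k\<close> makes the word long, and \<open>v\<close> tells the components of a
  tuple apart. The final \<open>b\<close> keeps a trailing run of \<open>a\<close> in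
  \<open>v\<close> from being the start of another marker.\<close>

definition marker :: "'a \<Rightarrow> 'a \<Rightarrow> nat \<Rightarrow> 'a list \<Rightarrow> 'a list" where
  "marker a b k v = replicate k a @ b # v @ [b]"

lemma length_marker: "length (marker a b k v) = k + length v + 2"
  by (simp add: marker_def)

lemma marker_occurrence:
  assumes "z = x @ marker a b k v @ y"
  shows "\<And>i. length x \<le> i \<Longrightarrow> i < length x + k \<Longrightarrow> z ! i = a"
    and "z ! (length x + k) = b"
    and "z ! (length x + k + length v + 1) = b"
    and "take (length v) (drop (length x + k + 1) z) = v"
  unfolding assms by (auto simp: marker_def nth_append)

text \<open>A run of \<open>a\<close>'s is longer than the words \<open>v\<close> and \<open>v'\<close>, so it fits nowhere inside the other
  marker except in that marker's own run, where the first \<open>b\<close>'s must coincide.\<close>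

lemma marker_overlap:
  assumes eq: "x @ marker a b k v @ y = x' @ marker a b k' v' @ y'"
    and ab: "a \<noteq> b" and len: "length v = l" "length v' = l" "l < k" "k \<le> k'"
    and overlap: "length x < length x' + length (marker a b k' v')"
      "length x' < length x + length (marker a b k v)"
  shows "length x + k = length x' + k' \<and> v = v'"
proof -
  define z p q where "z = x @ marker a b k v @ y" and "p = length x" and "q = length x'"
  have z': "z = x' @ marker a b k' v' @ y'" using eq z_def by simp
  note 1 = marker_occurrence[OF z_def, folded p_def, unfolded len]
  note 2 = marker_occurrence[OF z', folded q_def, unfolded len]
  have o: "p < q + k' + l + 2" "q < p + k + l + 2"
    using overlap len by (auto simp: length_marker p_def q_def)
  have notin1: "\<not> (p \<le> i \<and> i < p + k)" if "z ! i = b" for i using 1(1) ab that by blast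
  have notin2: "\<not> (q \<le> i \<and> i < q + k')" if "z ! i = b" for i using 2(1) ab that by blast
  \<comment> \<open>If the first \<open>b\<close>s differed, the one further left would lie before
    the other marker's run, and the overlap would put its last \<open>b\<close> behind that run. The
    run would then fit between these two \<open>b\<close>s and have at most \<open>l\<close>
    letters.\<close>
  have "p + k = q + k'"
    using notin1[OF 2(2)] notin1[OF 2(3)] notin2[OF 1(2)] notin2[OF 1(3)] o len by linarith
  then show ?thesis using 1(4) 2(4) by (simp add: p_def q_def)
qed

text \<open>With a common \<open>k\<close>, overlapping markers start at the same place and carry
  the same \<open>v\<close>; distinctness of \<open>vs\<close> then fixes the index, hence also the
  right-hand side.\<close>

lemma nonoverlapping_markers:
  assumes ab: "a \<noteq> b" and vs: "distinct vs" "\<forall>v\<in>set vs. length v = l" "l < k"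
  shows "nonoverlapping (set (zip (map (marker a b k) vs) ts))" (is "nonoverlapping ?R")
proof -
  have "length x + length s \<le> length x' \<or> length x' + length s' \<le> length x \<or>
     x = x' \<and> s = s' \<and> t = t' \<and> y = y'"
    if R: "(s, t) \<in> ?R" "(s', t') \<in> ?R" and eq: "x @ s @ y = x' @ s' @ y'" for s t s' t' x y x' y'
  proof -
    obtain i where i: "i < length vs" "i < length ts" "s = marker a b k (vs ! i)" "t = ts ! i"
      using R(1) by (auto simp: set_zip)
    obtain j where j: "j < length vs" "j < length ts" "s' = marker a b k (vs ! j)" "t' = ts ! j"
      using R(2) by (auto simp: set_zip)
    have l: "length (vs ! i) = l" "length (vs ! j) = l" using vs(2) i(1) j(1) by auto
    show ?thesis
    proof (rule ccontr)
      assume no: "\<not> ?thesis"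
      then have "length x + k = length x' + k \<and> vs ! i = vs ! j"
        using marker_overlap[OF eq[unfolded i(3) j(3)] ab l vs(3) order.refl]
        unfolding i(3) j(3) by linarith
      moreover from this have "i = j" using vs(1) i(1) j(1) by (simp add: nth_eq_iff_index_eq)
      ultimately show False using no eq i j by simp
    qed
  qed
  then show ?thesis unfolding nonoverlapping_def by blast
qed

text \<open>The bound \<open>m \<le> k\<close> acts twice: every rule shortens, so it can fire, and
  no marker fits into a word of length at most \<open>m\<close>.\<close>

lemma collapse_markers:
  assumes ab: "a \<noteq> b" and vs: "distinct vs" "\<forall>v\<in>set vs. length v = l" "l < k"
    and ts: "length ts = length vs" "\<forall>t\<in>set ts. length t \<le> m" "m \<le> k"
  shows "collapse (@) length m (map (marker a b k) vs) ts
    (word_nf (set (zip (map (marker a b k) vs) ts)))" (is "collapse _ _ _ ?s _ (word_nf ?R)")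
proof -
  note no = nonoverlapping_markers[OF ab vs, of ts]
  have "word_nf ?R (?s ! i) = word_nf ?R (ts ! i)" if "i < length ts" for i
  proof -
    have "(?s ! i, ts ! i) \<in> ?R" using that ts(1) by (auto simp: set_zip intro!: exI[of _ i])
    moreover have "length (ts ! i) < length (?s ! i)"
    proof -
      have "length (ts ! i) \<le> m" using ts(2) that by simp
      then show ?thesis using ts(1,3) that by (simp add: length_marker)
    qed
    ultimately have "rewrite_step ?R (?s ! i) (ts ! i)"
      unfolding rewrite_step_def by (metis append_Nil append_Nil2)
    then show ?thesis by (rule word_nf_step[OF no])
  qed
  moreover have "word_nf ?R z = z" if "length z \<le> m" for z
    using that ts(3)
    by (auto intro!: word_nf_irreducible simp: rewrite_step_def set_zip length_marker)
  moreover have "congruence (@) {(x, y). word_nf ?R x = word_nf ?R y}"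
    using word_nf_append[OF no]
    by (rule congruence_kernelI[where F = "\<lambda>x y. word_nf ?R (x @ y)"])
  ultimately show ?thesis using ts(1) by (simp add: collapse_def)
qed

text \<open>Induction on the length of \<open>z\<close>: cut out one occurrence of some
  \<open>s ! i\<close>, put \<open>Var i\<close> in its place and treat both sides recursively. The
  words in \<open>ts\<close> have shorter runs and other codes, so substituting them creates no new
  redex.\<close>

lemma marker_interpolation:
  assumes ab: "a \<noteq> b" and vs: "distinct vs" "\<forall>v\<in>set vs. length v = l" "l < k"
  defines "s \<equiv> map (marker a b k) vs"
  shows "\<exists>P\<in>word_polynomials (length vs). word_polyfun P s = z \<and>
    (\<forall>ts. length ts = length vs \<longrightarrow>
       (\<forall>t\<in>set ts. \<exists>j v. t = marker a b j v \<and> l < j \<and> j < k \<and> length v = l \<and> v \<notin> set vs) \<longrightarrow>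
       word_polyfun P ts = word_nf (set (zip s ts)) z)"
    (is "\<exists>P\<in>_. _ \<and> (\<forall>ts. _ \<longrightarrow> ?good ts \<longrightarrow> _)")
proof (induction "length z" arbitrary: z rule: less_induct)
  case less
  show ?case
  proof (cases "\<exists>x i y. i < length vs \<and> z = x @ s ! i @ y")
    case True
    then obtain x i y where i: "i < length vs" and z: "z = x @ s ! i @ y" by blast
    have si: "s ! i = marker a b k (vs ! i)" using i by (simp add: s_def)
    have "length x < length z" "length y < length z" by (simp_all add: z si length_marker)
    from less[OF this(1)] less[OF this(2)] obtain P Q where
      P: "P \<in> word_polynomials (length vs)" "word_polyfun P s = x"
        "\<And>ts. length ts = length vs \<Longrightarrow> ?good ts \<Longrightarrow> word_polyfun P ts = word_nf (set (zip s ts)) x" and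
      Q: "Q \<in> word_polynomials (length vs)" "word_polyfun Q s = y"
        "\<And>ts. length ts = length vs \<Longrightarrow> ?good ts \<Longrightarrow> word_polyfun Q ts = word_nf (set (zip s ts)) y"
      by blast
    have "word_polyfun (P @ [Var i] @ Q) ts = word_nf (set (zip s ts)) z"
      if ts: "length ts = length vs" "?good ts" for ts
    proof -
      let ?R = "set (zip s ts)" and ?x = "word_nf (set (zip s ts)) x"
        and ?y = "word_nf (set (zip s ts)) y"
      have no: "nonoverlapping ?R" using nonoverlapping_markers[OF ab vs] by (simp add: s_def)
      have "ts ! i \<in> set ts" using i ts(1) by simp
      then obtain j v where t: "ts ! i = marker a b j v" "l < j" "j < k" "length v = l" "v \<notin> set vs"
        using ts(2) by blast
      have "(s ! i, ts ! i) \<in> ?R" using i ts(1) by (auto simp: set_zip s_def intro!: exI[of _ i])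
      moreover have "length (ts ! i) < length (s ! i)"
        using i vs(2) t by (simp add: s_def length_marker)
      ultimately have "rewrite_step ?R z (x @ ts ! i @ y)"
        unfolding rewrite_step_def z by blast
      then have "word_nf ?R z = word_nf ?R (x @ ts ! i @ y)" by (rule word_nf_step[OF no])
      also have "\<dots> = word_nf ?R (?x @ ts ! i @ ?y)"
        using word_nf_context[OF no, of "[]" x "ts ! i @ y"]
          word_nf_context[OF no, of "?x @ ts ! i" y "[]"] by simp
      also have "\<dots> = ?x @ ts ! i @ ?y"
      proof (rule word_nf_irreducible, rule notI, elim exE)
        fix z' assume "rewrite_step ?R (?x @ ts ! i @ ?y) z'"
        then obtain p s' t' q where st: "(s', t') \<in> ?R" "length t' < length s'"
          and eq: "?x @ ts ! i @ ?y = p @ s' @ q"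
          unfolding rewrite_step_def by blast
        have step: "rewrite_step ?R (u @ s' @ w) (u @ t' @ w)" for u w
          unfolding rewrite_step_def using st by blast
        obtain v' where v': "s' = marker a b k v'" "v' \<in> set vs"
          using st(1) by (auto simp: s_def dest!: set_zip_leftD)
        \<comment> \<open>A redex meeting \<open>ts ! i\<close> would be a marker overlapping it,
          which forces equal codes. So any redex lies inside \<open>?x\<close> or \<open>?y\<close>,
          both of which are normal.\<close>
        have "length ?x + length (ts ! i) \<le> length p \<or> length p + length s' \<le> length ?x"
        proof (rule ccontr)
          assume "\<not> ?thesis"
          moreover have "length v' = l" using vs(2) v'(2) by simp
          ultimately have "v = v'"
            using marker_overlap[OF eq[unfolded t(1) v'(1)] ab t(4) _ t(2) less_imp_le[OF t(3)]]
            unfolding t(1) v'(1) by linarith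
          then show False using v'(2) t(5) by simp
        qed
        then show False
        proof
          assume "length ?x + length (ts ! i) \<le> length p"
          then obtain u where "?y = u @ s' @ q" using append_factors_disjoint[OF eq] by blast
          then show False using step[of u q] rewrite_step_word_nf by metis
        next
          assume "length p + length s' \<le> length ?x"
          then obtain u where "?x = p @ s' @ u"
            using append_factors_disjoint[OF eq[symmetric]] by blast
          then show False using step[of p u] rewrite_step_word_nf by metis
        qed
      qed
      finally show ?thesis using P(3)[OF ts] Q(3)[OF ts] by (simp add: word_polyfun_def)
    qed
    moreover have "word_polyfun (P @ [Var i] @ Q) s = z"
      using P(2) Q(2) z by (simp add: word_polyfun_def)
    moreover have "P @ [Var i] @ Q \<in> word_polynomials (length vs)"
      using P(1) Q(1) i by (auto simp: word_polynomials_def poly_alphabet_def)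
    ultimately show ?thesis by blast
  next
    case False
    have "word_polyfun (map Letter z) us = z" for us by (induction z) (auto simp: word_polyfun_def)
    moreover have "map Letter z \<in> word_polynomials (length vs)"
      by (auto simp: word_polynomials_def poly_alphabet_def)
    moreover have "word_nf (set (zip s ts)) z = z" for ts
      using False by (intro word_nf_irreducible) (auto simp: rewrite_step_def set_zip s_def)
    ultimately show ?thesis by metis
  qed
qed

section \<open>Word polynomials as functions, and the theorem for words\<close>

lemma congruence_preserving_word_polyfun:
  assumes "P \<in> word_polynomials n"
  shows "congruence_preserving (@) n (word_polyfun P)"
proof -
  have "(word_polyfun P ts, word_polyfun P ts') \<in> r"
    if r: "congruence (@) r" and ts: "\<forall>i<n. (ts ! i, ts' ! i) \<in> r" for r ts ts'
  proof -
    have refl: "(z, z) \<in> r" for z using r by (auto simp: congruence_def equiv_def refl_on_def)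
    have app: "(x @ y, x' @ y') \<in> r" if "(x, x') \<in> r" "(y, y') \<in> r" for x y x' y'
      using r that by (auto simp: congruence_def)
    show ?thesis using assms
    proof (induction P)
      case (Cons p P)
      have "P \<in> word_polynomials n" using Cons.prems by (simp add: word_polynomials_def)
      then have IH: "(word_polyfun P ts, word_polyfun P ts') \<in> r" by (rule Cons.IH)
      have p: "(word_polyfun [p] ts, word_polyfun [p] ts') \<in> r"
        using Cons.prems ts refl
        by (auto simp: word_polyfun_def word_polynomials_def poly_alphabet_def)
      show ?case using app[OF p IH] by (simp add: word_polyfun_def)
    qed (simp add: refl word_polyfun_def)
  qed
  then show ?thesis unfolding congruence_preserving_def by blast
qed

lemma finite_poly_alphabet: "finite (poly_alphabet n :: 'a::finite psym set)"
  by (simp add: poly_alphabet_def)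

text \<open>With nonempty arguments every symbol of \<open>P\<close> contributes a letter to the
  value, so \<open>P\<close> is no longer than \<open>w\<close>, and the alphabet is finite.\<close>

lemma finite_word_polyfun_fibre:
  fixes w :: "'a::finite list"
  assumes "\<forall>i<n. us ! i \<noteq> []"
  shows "finite {P \<in> word_polynomials n. word_polyfun P us = w}"
proof (rule finite_subset)
  have "length P \<le> length (word_polyfun P us)" if "P \<in> word_polynomials n" for P
    using that assms
  proof (induction P)
    case (Cons p P)
    then have "length P \<le> length (word_polyfun P us)" by (simp add: word_polynomials_def)
    moreover have "word_polyfun [p] us \<noteq> []"
      using Cons.prems by (auto simp: word_polyfun_def word_polynomials_def poly_alphabet_def)
    ultimately show ?case
      by (cases "word_polyfun [p] us") (auto simp: word_polyfun_def)
  qed simp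
  then show "{P \<in> word_polynomials n. word_polyfun P us = w} \<subseteq>
      {P. set P \<subseteq> poly_alphabet n \<and> length P \<le> length w}"
    by (auto simp: word_polynomials_def)
  show "finite {P :: 'a psym list. set P \<subseteq> poly_alphabet n \<and> length P \<le> length w}"
    using finite_poly_alphabet by (rule finite_lists_length_le)
qed

theorem word_affine_complete:
  fixes f :: "'a::finite list list \<Rightarrow> 'a list"
  assumes card: "card (UNIV :: 'a set) \<ge> 2" and f: "congruence_preserving (@) n f"
  shows "\<exists>P\<in>word_polynomials n. \<forall>us. length us = n \<longrightarrow> f us = word_polyfun P us"
proof -
  obtain a b :: 'a where ab: "a \<noteq> b"
    using card by (metis card_le_Suc0_iff_eq finite_code UNIV_I not_less_eq_eq numeral_2_eq_2)
  \<comment> \<open>These are \<open>2 * n\<close> distinct words of equal length, with a single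
    \<open>b\<close> at position \<open>i\<close>: the first half serves \<open>S\<close>, the
    second half \<open>T\<close>.\<close>
  define code where "code i = (replicate (2 * n) a)[i := b]" for i
  have code_inj: "inj_on code {..<2 * n}"
  proof (rule inj_onI)
    fix i j assume ij: "i \<in> {..<2 * n}" "j \<in> {..<2 * n}" "code i = code j"
    then have "code i ! i = code j ! i" by simp
    then show "i = j" using ij(1,2) ab by (auto simp: code_def nth_list_update split: if_splits)
  qed
  define vs ws where "vs = map code [0..<n]" and "ws = map code [n..<2 * n]"
  have vs: "distinct vs" "\<forall>v\<in>set vs. length v = 2 * n" "length vs = n"
    and ws: "distinct ws" "\<forall>v\<in>set ws. length v = 2 * n" "length ws = n"
    using code_inj by (auto simp: vs_def ws_def code_def distinct_map intro: inj_on_subset)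
  have disj: "set vs \<inter> set ws = {}"
    using inj_onD[OF code_inj] unfolding vs_def ws_def by fastforce
  \<comment> \<open>The run has to be longer than the codes, of length \<open>2 * n\<close>, and at
    least \<open>m\<close>.\<close>
  define S T where "S m = map (marker a b (m + 2 * n + 1)) vs"
    and "T m = map (marker a b (m + 2 * n + 1)) ws" for m
  show ?thesis
  proof (rule polynomial_interpolation[where S = S and T = T and len = length
        and N = "\<lambda>s t. word_nf (set (zip s t))", OF f])
    show "\<And>P. P \<in> word_polynomials n \<Longrightarrow> congruence_preserving (@) n (word_polyfun P)"
      by (rule congruence_preserving_word_polyfun)
    show "\<And>m. length (T m) = n" using ws by (simp add: T_def)
    show "finite {P \<in> word_polynomials n. word_polyfun P (T 0) = w}" for w
      using ws(3) by (intro finite_word_polyfun_fibre) (auto simp: T_def marker_def)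
    fix m and t :: "'a list list"
    assume t: "length t = n" "\<forall>u\<in>set t. length u \<le> m"
    show "collapse (@) length m (S m) t (word_nf (set (zip (S m) t)))"
      unfolding S_def using t vs by (intro collapse_markers[OF ab]) auto
    show "collapse (@) length m (T m) t (word_nf (set (zip (T m) t)))"
      unfolding T_def using t ws by (intro collapse_markers[OF ab]) auto
  next
    fix m z
    \<comment> \<open>A member of \<open>T k\<close> of length at most \<open>m\<close> has a run
      shorter than \<open>m\<close>, hence shorter than the runs in \<open>S m\<close>.\<close>
    have good: "\<exists>j v. t = marker a b j v \<and> 2 * n < j \<and> j < m + 2 * n + 1 \<and> length v = 2 * n \<and> v \<notin> set vs"
      if t: "t \<in> set (T k)" "length t \<le> m" for t k
    proof -
      obtain v where v: "t = marker a b (k + 2 * n + 1) v" "v \<in> set ws"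
        using t(1) by (auto simp: T_def)
      then have "length v = 2 * n" "v \<notin> set vs" using ws(2) disj by auto
      moreover from this have "k + 2 * n + 1 < m + 2 * n + 1"
        using t(2) v(1) by (simp add: length_marker)
      moreover have "2 * n < k + 2 * n + 1" by simp
      ultimately show ?thesis using v(1) by blast
    qed
    obtain P where "P \<in> word_polynomials n" "word_polyfun P (S m) = z"
      "\<And>ts. length ts = n \<Longrightarrow>
       \<forall>t\<in>set ts. \<exists>j v. t = marker a b j v \<and> 2 * n < j \<and> j < m + 2 * n + 1 \<and> length v = 2 * n \<and> v \<notin> set vs \<Longrightarrow>
       word_polyfun P ts = word_nf (set (zip (S m) ts)) z"
      using marker_interpolation[OF ab vs(1,2), of "m + 2 * n + 1" z]
      unfolding S_def[symmetric] vs(3) by auto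
    moreover have "length (T k) = n" for k using ws(3) by (simp add: T_def)
    ultimately show "\<exists>P\<in>word_polynomials n. word_polyfun P (S m) = z \<and>
        (\<forall>k. (\<forall>u\<in>set (T k). length u \<le> m) \<longrightarrow>
          word_polyfun P (T k) = word_nf (set (zip (S m) (T k))) z)"
      using good by blast
  qed
qed

section \<open>Trees\<close>

lemmas btree_star_induct = btree_induct_star[case_names empty leaf star]

text \<open>One pass from the leaves up: \<open>\<rho>\<close> acts once at each inner node, on the
  product of the results below. Its output is not normalized again, and leaves stay as they
  are.\<close>

primrec ne_tree_nf :: "('a btree \<Rightarrow> 'a btree) \<Rightarrow> 'a ne_tree \<Rightarrow> 'a btree" where
  "ne_tree_nf \<rho> (Leaf a) = leaf a"
| "ne_tree_nf \<rho> (Left_Only u) = \<rho> (ne_tree_nf \<rho> u \<star> Empty)"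
| "ne_tree_nf \<rho> (Right_Only u) = \<rho> (Empty \<star> ne_tree_nf \<rho> u)"
| "ne_tree_nf \<rho> (Both u v) = \<rho> (ne_tree_nf \<rho> u \<star> ne_tree_nf \<rho> v)"

primrec tree_nf :: "('a btree \<Rightarrow> 'a btree) \<Rightarrow> 'a btree \<Rightarrow> 'a btree" where
  "tree_nf \<rho> Empty = Empty"
| "tree_nf \<rho> (Nonempty u) = ne_tree_nf \<rho> u"

lemma tree_nf_star: "\<rho> Empty = Empty \<Longrightarrow> tree_nf \<rho> (x \<star> y) = \<rho> (tree_nf \<rho> x \<star> tree_nf \<rho> y)"
  by (cases x; cases y) simp_all

lemma size_star_less:
  assumes "x \<star> y \<noteq> Empty"
  shows "size x < size (x \<star> y)" "size y < size (x \<star> y)"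
  using assms by (cases x; cases y; simp)+

lemma tree_nf_small:
  assumes "\<forall>u. size u < K \<longrightarrow> \<rho> u = u" "\<rho> Empty = Empty"
  shows "size z < K \<Longrightarrow> tree_nf \<rho> z = z"
proof (induction z rule: btree_star_induct)
  case (star x y)
  show ?case
  proof (cases "x \<star> y = Empty")
    case False
    then have "size x < K" "size y < K" using size_star_less[OF False] star.prems by auto
    then show ?thesis using star assms by (simp add: tree_nf_star)
  qed simp
qed simp_all

text \<open>A leaf has size 2, so \<open>K \<ge> 3\<close> makes \<open>z\<close> a product. Its
  factors are too small to change, which leaves only the action of \<open>\<rho>\<close> at the
  root.\<close>

lemma tree_nf_root:
  assumes \<rho>: "\<forall>u. size u < K \<longrightarrow> \<rho> u = u" "\<rho> Empty = Empty" and z: "size z = K" "K \<ge> 3"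
  shows "tree_nf \<rho> z = \<rho> z"
proof -
  obtain x y where xy: "z = x \<star> y"
    using z by (induction z rule: btree_star_induct) auto
  have "z \<noteq> Empty" using z by auto
  then have "size x < K" "size y < K" using size_star_less[of x y] xy z(1) by auto
  then show ?thesis using xy tree_nf_star[of \<rho> x y] tree_nf_small[OF \<rho>] \<rho>(2) by simp
qed

definition replace_root :: "'a btree list \<Rightarrow> 'a btree list \<Rightarrow> 'a btree \<Rightarrow> 'a btree" where
  "replace_root s t z = (case map_of (zip s t) z of None \<Rightarrow> z | Some u \<Rightarrow> u)"

lemma replace_root_nth:
  "distinct s \<Longrightarrow> length s = length t \<Longrightarrow> i < length t \<Longrightarrow> replace_root s t (s ! i) = t ! i"
  by (simp add: replace_root_def map_of_zip_nth)

lemma replace_root_notin: "length s = length t \<Longrightarrow> z \<notin> set s \<Longrightarrow> replace_root s t z = z"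
  by (simp add: replace_root_def map_of_zip_is_None[THEN iffD2])

text \<open>The kernel is a congruence by the recursion for \<open>tree_nf\<close>. As all
  \<open>s ! i\<close> have the same size \<open>K\<close>, their proper subtrees stay fixed, and so
  does everything of size at most \<open>m\<close>.\<close>

lemma collapse_trees:
  assumes s: "distinct s" "\<forall>u\<in>set s. size u = K" "K \<ge> 3" "m < K"
    and t: "length t = length s" and ts: "\<forall>u\<in>set t. size u \<le> m"
  shows "collapse (\<star>) size m s t (tree_nf (replace_root s t))"
proof -
  let ?\<rho> = "replace_root s t"
  have \<rho>: "\<forall>u. size u < K \<longrightarrow> ?\<rho> u = u" "?\<rho> Empty = Empty"
    using s t by (auto intro!: replace_root_notin)
  have "tree_nf ?\<rho> (s ! i) = tree_nf ?\<rho> (t ! i)" if "i < length t" "size (t ! i) \<le> m" for i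
  proof -
    have "size (s ! i) = K" using s(2) t that(1) by simp
    then have "tree_nf ?\<rho> (s ! i) = t ! i"
      using tree_nf_root[OF \<rho>] s(1,3) t that(1) by (simp add: replace_root_nth)
    then show ?thesis using tree_nf_small[OF \<rho>] that(2) s(4) by simp
  qed
  moreover have "congruence (\<star>) {(x, y). tree_nf ?\<rho> x = tree_nf ?\<rho> y}"
    using tree_nf_star[of ?\<rho>] \<rho>(2)
    by (intro congruence_kernelI[where F = "\<lambda>x y. ?\<rho> (x \<star> y)"])
  moreover have "tree_nf ?\<rho> z = z" if "size z \<le> m" for z
    using tree_nf_small[OF \<rho>] that s(4) by simp
  ultimately show ?thesis using t ts by (simp add: collapse_def)
qed

section \<open>Chains and interpolation\<close>

text \<open>Chains separate the two families: \<open>S\<close> will consist of chains and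
  \<open>T\<close> of trees that are not, and no tree with a non-chain below it is a chain.\<close>

primrec ne_chain :: "'a ne_tree \<Rightarrow> bool" where
  "ne_chain (Leaf a) = True"
| "ne_chain (Left_Only u) = ne_chain u"
| "ne_chain (Right_Only u) = ne_chain u"
| "ne_chain (Both u v) = False"

primrec chain :: "'a btree \<Rightarrow> bool" where
  "chain Empty = True"
| "chain (Nonempty u) = ne_chain u"

lemma chain_star: "chain (x \<star> y) \<Longrightarrow> chain x \<and> chain y"
  by (cases x; cases y) simp_all

text \<open>A replacement inserts a member of \<open>t\<close>, which is not a chain, and nothing
  built above it becomes a chain again. A result that is a chain therefore arose without
  replacement.\<close>

lemma chain_tree_nf:
  assumes t: "length s = length t" "\<forall>u\<in>set t. \<not> chain u" and E: "Empty \<notin> set s"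
  shows "chain (tree_nf (replace_root s t) z) \<Longrightarrow> tree_nf (replace_root s t) z = z"
proof (induction z rule: btree_star_induct)
  case (star x y)
  let ?\<rho> = "replace_root s t"
  let ?w = "tree_nf ?\<rho> x \<star> tree_nf ?\<rho> y"
  have nf: "tree_nf ?\<rho> (x \<star> y) = ?\<rho> ?w"
    using E t(1) by (intro tree_nf_star replace_root_notin)
  have "?\<rho> ?w = ?w"
  proof (rule ccontr)
    assume ne: "?\<rho> ?w \<noteq> ?w"
    then have "map_of (zip s t) ?w \<noteq> None" by (auto simp: replace_root_def split: option.splits)
    then obtain u where u: "map_of (zip s t) ?w = Some u" by auto
    then have "u \<in> set t" by (meson map_of_SomeD set_zip_rightD)
    moreover have "?\<rho> ?w = u" using u by (simp add: replace_root_def)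
    ultimately show False using t(2) star.prems nf by simp
  qed
  then show ?case using nf star chain_star[of "tree_nf ?\<rho> x" "tree_nf ?\<rho> y"] by simp
qed simp_all

lemma labels_star: "labels (P \<star> Q) = labels P \<union> labels Q"
  by (cases P; cases Q) simp_all

lemma tree_polynomials_intros:
  "Empty \<in> tree_polynomials n"
  "leaf (Letter a) \<in> tree_polynomials n"
  "i < n \<Longrightarrow> leaf (Var i) \<in> tree_polynomials n"
  "P \<in> tree_polynomials n \<Longrightarrow> Q \<in> tree_polynomials n \<Longrightarrow> P \<star> Q \<in> tree_polynomials n"
  by (auto simp: tree_polynomials_def poly_alphabet_def labels_star)

lemma chain_interpolation:
  assumes s: "distinct s" "\<forall>u\<in>set s. chain u \<and> size u = K" "K \<ge> 3"
  shows "\<exists>P\<in>tree_polynomials (length s). tree_polyfun P s = z \<and>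
    (\<forall>t. length t = length s \<longrightarrow> (\<forall>u\<in>set t. \<not> chain u) \<longrightarrow>
       tree_polyfun P t = tree_nf (replace_root s t) z)"
proof (induction z rule: btree_star_induct)
  case empty
  show ?case by (rule bexI[of _ Empty]) (simp_all add: tree_polynomials_intros)
next
  case (leaf a)
  show ?case
    by (rule bexI[of _ "leaf (Letter a)"]) (simp_all add: tree_polynomials_intros del: One_nat_def)
next
  case (star x y)
  have E: "Empty \<notin> set s" using s(2,3) by force
  show ?case
  proof (cases "x \<star> y \<in> set s")
    case True
    then obtain i where i: "i < length s" "x \<star> y = s ! i" by (metis in_set_conv_nth)
    have "tree_nf (replace_root s t) (s ! i) = t ! i" if t: "length t = length s" for t
    proof -
      have "tree_nf (replace_root s t) (s ! i) = replace_root s t (s ! i)"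
        using s t E i(1) by (intro tree_nf_root[of K]) (auto intro!: replace_root_notin)
      then show ?thesis using replace_root_nth[of s t i] s(1) t i(1) by simp
    qed
    then show ?thesis
      using i by (intro bexI[of _ "leaf (Var i)"]) (simp_all add: tree_polynomials_intros)
  next
    case False
    obtain P Q where
      P: "P \<in> tree_polynomials (length s)" "tree_polyfun P s = x"
        "\<And>t. length t = length s \<Longrightarrow> \<forall>u\<in>set t. \<not> chain u \<Longrightarrow>
          tree_polyfun P t = tree_nf (replace_root s t) x" and
      Q: "Q \<in> tree_polynomials (length s)" "tree_polyfun Q s = y"
        "\<And>t. length t = length s \<Longrightarrow> \<forall>u\<in>set t. \<not> chain u \<Longrightarrow>
          tree_polyfun Q t = tree_nf (replace_root s t) y"
      using star.IH by blast
    have "tree_polyfun (P \<star> Q) t = tree_nf (replace_root s t) (x \<star> y)"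
      if t: "length t = length s" "\<forall>u\<in>set t. \<not> chain u" for t
    proof -
      let ?N = "tree_nf (replace_root s t)"
      \<comment> \<open>No new redex arises at the root: members of \<open>s\<close> are chains, so
        hitting one would mean that nothing was replaced below, and \<open>x \<star> y\<close>
        itself is not in \<open>s\<close>.\<close>
      have "?N x \<star> ?N y \<notin> set s"
      proof
        assume in_s: "?N x \<star> ?N y \<in> set s"
        then have "chain (?N x)" "chain (?N y)" using s(2) chain_star by blast+
        then have "?N x \<star> ?N y = x \<star> y" using chain_tree_nf[OF t(1)[symmetric] t(2) E] by metis
        then show False using in_s False by simp
      qed
      then have "?N (x \<star> y) = ?N x \<star> ?N y"
        by (metis tree_nf_star replace_root_notin t(1) E)
      then show ?thesis using P(3)[OF t] Q(3)[OF t] by (simp add: tree_polyfun_simps)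
    qed
    moreover have "tree_polyfun (P \<star> Q) s = x \<star> y" using P(2) Q(2) by (simp add: tree_polyfun_simps)
    ultimately show ?thesis using P(1) Q(1) tree_polynomials_intros(4) by blast
  qed
qed

section \<open>Tree polynomials as functions\<close>

lemma congruence_preserving_tree_polyfun:
  assumes "P \<in> tree_polynomials n"
  shows "congruence_preserving (\<star>) n (tree_polyfun P)"
proof -
  have "(tree_polyfun P ts, tree_polyfun P ts') \<in> r"
    if r: "congruence (\<star>) r" and ts: "\<forall>i<n. (ts ! i, ts' ! i) \<in> r" for r ts ts'
  proof -
    have refl: "(z, z) \<in> r" for z using r by (auto simp: congruence_def equiv_def refl_on_def)
    show ?thesis using assms
    proof (induction P rule: btree_star_induct)
      case (leaf p)
      then show ?case using ts refl by (auto simp: tree_polynomials_def poly_alphabet_def)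
    next
      case (star P Q)
      then show ?case
        using r by (simp add: tree_polynomials_def labels_star tree_polyfun_simps congruence_def)
    qed (simp add: refl)
  qed
  then show ?thesis unfolding congruence_preserving_def by blast
qed

text \<open>With nonempty arguments no nonempty polynomial vanishes. By unique factorization, one
  with value \<open>w\<close> is then a single leaf or has the root shape of \<open>w\<close>, with
  the subtrees of \<open>w\<close> as values of its parts; induction on \<open>w\<close> leaves
  finitely many.\<close>

lemma finite_tree_polyfun_fibre:
  fixes w :: "'a::finite btree"
  assumes us: "\<forall>i<n. us ! i \<noteq> Empty"
  shows "finite {P \<in> tree_polynomials n. tree_polyfun P us = w}"
proof -
  let ?A = "poly_alphabet n :: 'a psym set"
  have nonempty: "ne_tree_polyfun P us \<noteq> Empty" if "labels_ne P \<subseteq> ?A" for P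
    using that us by (induction P) (auto simp: tree_star_eq_Empty_iff poly_alphabet_def)
  define F where "F w = {P. labels_ne P \<subseteq> ?A \<and> ne_tree_polyfun P us = Nonempty w}" for w
  have star_eq: "x \<star> y = Nonempty w \<longleftrightarrow> (case w of Leaf _ \<Rightarrow> False
      | Left_Only u \<Rightarrow> x = Nonempty u \<and> y = Empty | Right_Only v \<Rightarrow> x = Empty \<and> y = Nonempty v
      | Both u v \<Rightarrow> x = Nonempty u \<and> y = Nonempty v)" for x y :: "'a btree" and w
    by (cases x; cases y) (auto split: ne_tree.split)
  have F_cases: "P \<in> Leaf ` ?A \<or> (case w of Leaf _ \<Rightarrow> False
      | Left_Only u \<Rightarrow> P \<in> Left_Only ` F u | Right_Only v \<Rightarrow> P \<in> Right_Only ` F v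
      | Both u v \<Rightarrow> P \<in> case_prod Both ` (F u \<times> F v))" if "P \<in> F w" for P w
    using that nonempty by (cases P) (auto simp: F_def star_eq split: ne_tree.splits)
  have "finite (F w)" for w
  proof (induction w)
    case (Leaf a)
    have "F (Leaf a) \<subseteq> Leaf ` ?A" using F_cases[of _ "Leaf a"] by auto
    then show ?case using finite_poly_alphabet by (blast intro: finite_subset)
  next
    case (Left_Only u)
    have "F (Left_Only u) \<subseteq> Leaf ` ?A \<union> Left_Only ` F u"
      using F_cases[of _ "Left_Only u"] by auto
    then show ?case using Left_Only finite_poly_alphabet
      by (blast intro: finite_subset finite_UnI)
  next
    case (Right_Only u)
    have "F (Right_Only u) \<subseteq> Leaf ` ?A \<union> Right_Only ` F u"
      using F_cases[of _ "Right_Only u"] by auto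
    then show ?case using Right_Only finite_poly_alphabet
      by (blast intro: finite_subset finite_UnI)
  next
    case (Both u v)
    have "F (Both u v) \<subseteq> Leaf ` ?A \<union> case_prod Both ` (F u \<times> F v)"
      using F_cases[of _ "Both u v"] by fastforce
    then show ?case using Both finite_poly_alphabet
      by (blast intro: finite_subset finite_UnI finite_cartesian_product)
  qed
  moreover have "{P \<in> tree_polynomials n. tree_polyfun P us = w} \<subseteq>
      insert Empty (case w of Empty \<Rightarrow> {} | Nonempty u \<Rightarrow> Nonempty ` F u)"
  proof
    fix P assume "P \<in> {P \<in> tree_polynomials n. tree_polyfun P us = w}"
    then show "P \<in> insert Empty (case w of Empty \<Rightarrow> {} | Nonempty u \<Rightarrow> Nonempty ` F u)"
      using nonempty by (cases P) (auto simp: tree_polynomials_def F_def split: btree.split)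
  qed
  ultimately show ?thesis by (auto intro: finite_subset split: btree.splits)
qed

section \<open>Concrete families of trees, and the theorem for trees\<close>

text \<open>One right step among \<open>k\<close> left steps, placed at depth \<open>i\<close>: a
  single letter already yields distinct chains of equal size.\<close>

definition zigzag :: "'a \<Rightarrow> nat \<Rightarrow> nat \<Rightarrow> 'a ne_tree" where
  "zigzag a k i = (Left_Only ^^ i) (Right_Only ((Left_Only ^^ (k - i)) (Leaf a)))"

lemma zigzag_inject: "zigzag a k i = zigzag a k j \<longleftrightarrow> i = j"
proof -
  have "(Left_Only ^^ i) (Right_Only u) = (Left_Only ^^ j) (Right_Only v) \<Longrightarrow> i = j"
    for u v :: "'a ne_tree"
  proof (induction i arbitrary: j)
    case 0 then show ?case by (cases j) simp_all
  next
    case (Suc i) then show ?case by (cases j) simp_all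
  qed
  then show ?thesis by (auto simp: zigzag_def)
qed

lemma size_zigzag: "i \<le> k \<Longrightarrow> size (zigzag a k i) = k + 2"
proof -
  have "size ((Left_Only ^^ i) u) = i + size u" for i and u :: "'a ne_tree"
    by (induction i) simp_all
  then show "i \<le> k \<Longrightarrow> ?thesis" by (simp add: zigzag_def)
qed

lemma ne_chain_zigzag: "ne_chain (zigzag a k i)"
proof -
  have "ne_chain ((Left_Only ^^ i) u) = ne_chain u" for i and u :: "'a ne_tree"
    by (induction i) simp_all
  then show ?thesis by (simp add: zigzag_def)
qed

theorem tree_affine_complete:
  fixes f :: "'a::finite btree list \<Rightarrow> 'a btree"
  assumes f: "congruence_preserving (\<star>) n f"
  shows "\<exists>P\<in>tree_polynomials n. \<forall>us. length us = n \<longrightarrow> f us = tree_polyfun P us"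
proof -
  fix a :: 'a
  \<comment> \<open>The parameter \<open>m + n\<close> is at least every \<open>i < n\<close>, as
    the size formula requires, and pushes all sizes above \<open>m\<close>. Doubling a zigzag
    branches at the root, so it is not a chain.\<close>
  define S T where "S m = map (\<lambda>i. Nonempty (zigzag a (m + n) i)) [0..<n]"
    and "T m = map (\<lambda>i. Nonempty (Both (zigzag a (m + n) i) (zigzag a (m + n) i))) [0..<n]" for m
  have S: "distinct (S m)" "\<forall>u\<in>set (S m). chain u \<and> size u = m + n + 3" "length (S m) = n" for m
    by (auto simp: S_def distinct_map inj_on_def zigzag_inject ne_chain_zigzag size_zigzag)
  have T: "distinct (T m)" "\<forall>u\<in>set (T m). \<not> chain u \<and> size u = 2 * (m + n) + 6" "length (T m) = n" for m
    by (auto simp: T_def distinct_map inj_on_def zigzag_inject size_zigzag)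
  show ?thesis
  proof (rule polynomial_interpolation[where S = S and T = T and len = size
        and N = "\<lambda>s t. tree_nf (replace_root s t)", OF f])
    show "\<And>P. P \<in> tree_polynomials n \<Longrightarrow> congruence_preserving (\<star>) n (tree_polyfun P)"
      by (rule congruence_preserving_tree_polyfun)
    show "\<And>m. length (T m) = n" by (rule T)
    show "finite {P \<in> tree_polynomials n. tree_polyfun P (T 0) = w}" for w
      by (intro finite_tree_polyfun_fibre) (auto simp: T_def)
    fix m and t :: "'a btree list"
    assume t: "length t = n" "\<forall>u\<in>set t. size u \<le> m"
    show "collapse (\<star>) size m (S m) t (tree_nf (replace_root (S m) t))"
      using S t by (intro collapse_trees[where K = "m + n + 3"]) auto
    show "collapse (\<star>) size m (T m) t (tree_nf (replace_root (T m) t))"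
      using T t by (intro collapse_trees[where K = "2 * (m + n) + 6"]) auto
  next
    fix m z
    show "\<exists>P\<in>tree_polynomials n. tree_polyfun P (S m) = z \<and>
        (\<forall>k. (\<forall>u\<in>set (T k). size u \<le> m) \<longrightarrow>
          tree_polyfun P (T k) = tree_nf (replace_root (S m) (T k)) z)"
    proof -
      have "\<forall>u\<in>set (T k). \<not> chain u" for k using T(2) by blast
      moreover have "\<forall>u\<in>set (S m). chain u \<and> size u = m + n + 3" by (rule S)
      moreover have "3 \<le> m + n + 3" by simp
      ultimately show ?thesis
        using chain_interpolation[OF S(1), of m "m + n + 3" z] unfolding S(3) using T(3) by blast
    qed
  qed
qed

theorem theorem2p7:
  fixes n :: nat
    and f :: "'a::finite list list \<Rightarrow> 'a list"
    and g :: "'a btree list \<Rightarrow> 'a btree"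
  shows "(card (UNIV :: 'a set) \<ge> 2 \<and> congruence_preserving (@) n f \<longrightarrow>
            (\<exists>P \<in> word_polynomials n. \<forall>us. length us = n \<longrightarrow> f us = word_polyfun P us))
       \<and> (card (UNIV :: 'a set) \<ge> 1 \<and> congruence_preserving (\<star>) n g \<longrightarrow>
            (\<exists>P \<in> tree_polynomials n. \<forall>us. length us = n \<longrightarrow> g us = tree_polyfun P us))"
  using word_affine_complete tree_affine_complete by blast

end
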